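(* For any $a,b,c\in\mathbb{N}_0$, $$t^{\star}(\{2\}^{a},3,\{2\}^{b},1,\{2\}^{c})=-\frac{4}{\pi}t(\overline{2a+2b+2c+5})-\frac{8}{\pi}t(\overline{2a+2},2b+2c+3)-\frac{8}{\pi}t(2a+2b+4,\overline{2c+1})-\frac{16}{\pi}t(\overline{2a+2},\overline{2b+2},\overline{2c+1})$$ and $$t^{\star}(\{2\}^{a},3,\{2\}^{b},3,\{2\}^{c})=-\frac{4}{\pi}t(\overline{2a+2b+2c+7})-\frac{8}{\pi}t(\overline{2a+2},2b+2c+5)-\frac{8}{\pi}t(\overline{2a+2b+5},2c+2)-\frac{16}{\pi}t(\overline{2a+2},2b+3,2c+2).$$
   Context: $t^{\star}(\boldsymbol{s})=\sum_{k_1\geq\cdots\geq k_r\geq1}\prod_{j}(2k_j-1)^{-s_j}$ for an index with $s_1>1$; $\{2\}^a$ is $2$ repeated $a$ times. Alternating multiple $t$-values: $t(\boldsymbol{s};\boldsymbol{\sigma})=\sum_{k_1>\cdots>k_r\geq1}\prod_{j}\frac{\sigma_j^{k_j}}{(2k_j-1)^{s_j}}$, where a bar over $s_j$ means $\sigma_j=-1$ and no bar means $\sigma_j=1$. *)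

theory Defs
  imports "HOL-Analysis.Analysis"
begin

definition tstar :: "nat list \<Rightarrow> real" where
  "tstar s = infsum (\<lambda>ks. \<Prod>j<length s. 1 / (2 * real (ks ! j) - 1) ^ (s ! j))
     {ks. length ks = length s \<and> sorted_wrt (\<ge>) ks \<and> (\<forall>k\<in>set ks. 1 \<le> k)}"

text \<open>Alternating multiple t-value: index list of pairs (s_j, barred_j);
  barred means sigma_j = -1, otherwise sigma_j = 1;
  sum over k_1 > ... > k_r \<ge> 1 of prod_j sigma_j^(k_j) / (2k_j - 1)^(s_j).\<close>
definition tval :: "(nat \<times> bool) list \<Rightarrow> real" where
  "tval s = infsum (\<lambda>ks. \<Prod>j<length s.
        (if snd (s ! j) then (-1) ^ (ks ! j) else 1) / (2 * real (ks ! j) - 1) ^ fst (s ! j))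
     {ks. length ks = length s \<and> sorted_wrt (>) ks \<and> (\<forall>k\<in>set ks. 1 \<le> k)}"

end

theory Submission
  imports Defs "HOL-Real_Asymp.Real_Asymp"
begin

text \<open>
  The truncated star sum \<open>T\<^sub>n(s)\<close> over \<open>n \<ge> k\<^sub>1 \<ge> \<dots> \<ge> k\<^sub>r \<ge> 1\<close> is written as
  \<open>\<Sum>k\<le>n. K n k * f\<^sub>s k\<close> with the kernel
  \<open>K n k = (1/2)\<^sub>n\<^sup>2 / ((n - k)! (n + k - 1)!)\<close>, where \<open>(1/2)\<^sub>n\<close> is a rising factorial.
  The kernel satisfies \<open>K n k - K (n-1) k = ((2k - 1) / (2n - 1))\<^sup>2 K n k\<close>,
  so prepending an entry 2 to \<open>s\<close> just divides \<open>f\<^sub>s k\<close> by \<open>(2k - 1)\<^sup>2\<close>.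
  Telescoping in \<open>k\<close> shows that prepending 1 or 3 replaces \<open>f\<^sub>s\<close> by (a twist of)
  \<open>f\<^sub>s k + 2 * (\<Sum>l<k. f\<^sub>s l)\<close>, and for the empty index \<open>f k = -4 (-1)^k / (2k - 1)\<close>.
  By Wallis' product \<open>K n k\<close> increases to \<open>1 / \<pi>\<close> as \<open>n\<close> grows, so by Tannery's theorem the limit
  of \<open>T\<^sub>n(s)\<close> is \<open>1 / \<pi>\<close> times the sum of \<open>f\<^sub>s\<close>; expanding \<open>f\<^sub>s\<close> gives the alternating t-values.
\<close>

subsection \<open>Nested sums\<close>

text \<open>The gap \<open>d\<close> is 0 for the weakly decreasing indices of star values and 1 for the strictly
  decreasing indices of t-values.\<close>

definition gap_lists :: "nat \<Rightarrow> nat \<Rightarrow> nat \<Rightarrow> nat list set" where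
  "gap_lists d r n = {ks. length ks = r \<and> sorted_wrt (\<lambda>x y. y + d \<le> x) ks \<and> set ks \<subseteq> {1..n}}"

primrec nsum :: "nat \<Rightarrow> (nat \<Rightarrow> real) list \<Rightarrow> nat \<Rightarrow> real" where
  "nsum d [] n = 1"
| "nsum d (w # ws) n = (\<Sum>k=1..n. w k * nsum d ws (k - d))"

lemma finite_gap_lists: "finite (gap_lists d r n)"
  by (rule finite_subset[OF _ finite_lists_length_eq[of "{1..n}" r]]) (auto simp: gap_lists_def)

lemma gap_lists_mono: "m \<le> n \<Longrightarrow> gap_lists d r m \<subseteq> gap_lists d r n"
  by (auto simp: gap_lists_def)

lemma gap_lists_Suc: "gap_lists d (Suc r) n = (\<Union>k\<in>{1..n}. (#) k ` gap_lists d r (k - d))"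
proof (intro equalityI subsetI)
  fix ks assume "ks \<in> gap_lists d (Suc r) n"
  then show "ks \<in> (\<Union>k\<in>{1..n}. (#) k ` gap_lists d r (k - d))"
    by (cases ks) (force simp: gap_lists_def)+
next
  fix ks assume "ks \<in> (\<Union>k\<in>{1..n}. (#) k ` gap_lists d r (k - d))"
  then show "ks \<in> gap_lists d (Suc r) n"
    by (fastforce simp: gap_lists_def)
qed

lemma sum_gap_lists_eq_nsum:
  "(\<Sum>ks\<in>gap_lists d (length ws) n. \<Prod>j<length ws. (ws ! j) (ks ! j)) = nsum d ws n"
proof (induction ws arbitrary: n)
  case Nil
  have "gap_lists d 0 n = {[]}" by (auto simp: gap_lists_def)
  then show ?case by simp
next
  case (Cons w ws)
  let ?r = "length ws"
  have "(\<Sum>ks\<in>gap_lists d (Suc ?r) n. \<Prod>j<Suc ?r. ((w # ws) ! j) (ks ! j)) =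
      (\<Sum>k=1..n. \<Sum>ks\<in>(#) k ` gap_lists d ?r (k - d). \<Prod>j<Suc ?r. ((w # ws) ! j) (ks ! j))"
    unfolding gap_lists_Suc by (rule sum.UNION_disjoint) (auto simp: finite_gap_lists)
  also have "\<dots> = (\<Sum>k=1..n. w k * nsum d ws (k - d))"
  proof (rule sum.cong[OF refl])
    fix k
    show "(\<Sum>ks\<in>(#) k ` gap_lists d ?r (k - d). \<Prod>j<Suc ?r. ((w # ws) ! j) (ks ! j)) =
        w k * nsum d ws (k - d)"
      unfolding Cons.IH[symmetric]
      by (subst sum.reindex) (auto simp: prod.lessThan_Suc_shift sum_distrib_left simp del: prod.lessThan_Suc)
  qed
  finally show ?case by simp
qed

text \<open>The gap lists with entries up to \<open>n\<close> exhaust the index set. The bound on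
  absolute values gives absolute summability, so the limit over finite subsets may be taken along
  this one sequence of sets.\<close>

lemma nsum_tendsto_infsum:
  assumes "\<And>n. nsum d (map (\<lambda>w k. \<bar>w k\<bar>) ws) n \<le> M"
  shows "nsum d ws \<longlonglongrightarrow>
    infsum (\<lambda>ks. \<Prod>j<length ws. (ws ! j) (ks ! j)) (\<Union>n. gap_lists d (length ws) n)"
proof -
  let ?A = "\<Union>n. gap_lists d (length ws) n"
  let ?f = "\<lambda>ks. \<Prod>j<length ws. (ws ! j) (ks ! j)"
  have cover: "\<exists>n. X \<subseteq> gap_lists d (length ws) n" if "finite X" "X \<subseteq> ?A" for X
    using that
  proof (induction X rule: finite_induct)
    case (insert x X)
    then obtain m n where "X \<subseteq> gap_lists d (length ws) m" "x \<in> gap_lists d (length ws) n" by auto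
    then have "insert x X \<subseteq> gap_lists d (length ws) (max m n)"
      using gap_lists_mono[of m "max m n" d "length ws"] gap_lists_mono[of n "max m n" d "length ws"]
      by auto
    then show ?case by blast
  qed simp
  have abs_eq: "(\<Sum>ks\<in>gap_lists d (length ws) n. norm (?f ks)) = nsum d (map (\<lambda>w k. \<bar>w k\<bar>) ws) n" for n
    using sum_gap_lists_eq_nsum[where d = d and ws = "map (\<lambda>w k. \<bar>w k\<bar>) ws" and n = n] by (simp add: abs_prod)
  have "(\<lambda>ks. norm (?f ks)) summable_on ?A"
    unfolding abs_summable_iff_bdd_above
  proof (rule bdd_aboveI2)
    fix X assume "X \<in> {F. F \<subseteq> ?A \<and> finite F}"
    then obtain n where "X \<subseteq> gap_lists d (length ws) n" using cover by blast
    then have "(\<Sum>ks\<in>X. norm (?f ks)) \<le> (\<Sum>ks\<in>gap_lists d (length ws) n. norm (?f ks))"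
      by (intro sum_mono2 finite_gap_lists) auto
    also have "\<dots> \<le> M" using assms abs_eq by simp
    finally show "(\<Sum>ks\<in>X. norm (?f ks)) \<le> M" .
  qed
  then have "(?f has_sum infsum ?f ?A) ?A"
    by (intro has_sum_infsum) (rule abs_summable_summable)
  then have lim: "(sum ?f \<longlongrightarrow> infsum ?f ?A) (finite_subsets_at_top ?A)"
    by (simp add: has_sum_def)
  have "filterlim (gap_lists d (length ws)) (finite_subsets_at_top ?A) sequentially"
    unfolding filterlim_finite_subsets_at_top
  proof (intro allI impI)
    fix X assume "finite X \<and> X \<subseteq> ?A"
    then obtain m where "X \<subseteq> gap_lists d (length ws) m" using cover by blast
    then show "\<forall>\<^sub>F n in sequentially. finite (gap_lists d (length ws) n) \<and>
        X \<subseteq> gap_lists d (length ws) n \<and> gap_lists d (length ws) n \<subseteq> ?A"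
      using gap_lists_mono[of m _ d "length ws"]
      by (intro eventually_sequentiallyI[of m]) (auto simp: finite_gap_lists)
  qed
  from filterlim_compose[OF lim this] show ?thesis
    by (simp add: sum_gap_lists_eq_nsum)
qed

lemma abs_nsum_le: "\<bar>nsum d ws n\<bar> \<le> nsum d (map (\<lambda>w k. \<bar>w k\<bar>) ws) n"
proof (induction ws arbitrary: n)
  case (Cons w ws)
  show ?case
    by (auto simp: abs_mult intro!: order.trans[OF sum_abs] sum_mono mult_left_mono Cons.IH)
qed simp

section \<open>Growth bounds for nested sums\<close>

lemma sum_Suc_powr_le:
  assumes "s < (-1::real)"
  shows "(\<Sum>k=1..n. real (Suc k) powr s) \<le> (\<Sum>k. real k powr s)"
proof -
  have "(\<Sum>k=1..n. real (Suc k) powr s) = (\<Sum>k\<in>{2..Suc n}. real k powr s)"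
    using sum.shift_bounds_cl_Suc_ivl[of "\<lambda>k. real k powr s" 1 n] by (simp add: numeral_2_eq_2)
  also have "\<dots> \<le> (\<Sum>k. real k powr s)"
    using assms by (intro sum_le_suminf) (auto simp: summable_real_powr_iff)
  finally show ?thesis .
qed

text \<open>Weights of size 1/k allow at most growth by a power of the logarithm. An arbitrarily
  small power of \<open>n\<close> is a weaker bound that survives the induction on the
  depth.\<close>

lemma nsum_powr_bound:
  assumes "\<And>w k. w \<in> set ws \<Longrightarrow> k \<ge> 1 \<Longrightarrow> 0 \<le> w k \<and> w k \<le> 1 / real k" and "e > 0"
  shows "\<exists>C\<ge>0. \<forall>n. nsum d ws n \<le> C * real (Suc n) powr e"
  using assms
proof (induction ws arbitrary: e)
  case Nil
  then show ?case by (intro exI[of _ 1]) (auto intro: ge_one_powr_ge_zero)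
next
  case (Cons w ws)
  have "\<exists>C\<ge>0. \<forall>n. nsum d ws n \<le> C * real (Suc n) powr (e / 2)"
    using Cons.prems by (intro Cons.IH) auto
  then obtain C where C: "C \<ge> 0" "\<And>n. nsum d ws n \<le> C * real (Suc n) powr (e / 2)" by blast
  define Z where "Z = (\<Sum>k. real k powr (- 1 - e / 2))"
  have "Z \<ge> 0"
    unfolding Z_def using Cons.prems by (intro suminf_nonneg) (auto simp: summable_real_powr_iff)
  have "nsum d (w # ws) n \<le> (2 * C * Z) * real (Suc n) powr e" for n
  proof -
    have "w k * nsum d ws (k - d) \<le> 2 * C * real (Suc n) powr e * real (Suc k) powr (- 1 - e / 2)"
      if k: "k \<in> {1..n}" for k
    proof -
      have wk: "0 \<le> w k" "w k \<le> 1 / real k" using Cons.prems(1)[of w k] k by auto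
      have "w k \<le> 2 / real (Suc k)"
        by (rule order.trans[OF wk(2)]) (use k in \<open>auto simp: field_simps\<close>)
      moreover have "nsum d ws (k - d) \<le> C * real (Suc k) powr (e / 2)"
        by (rule order.trans[OF C(2)]) (use C Cons.prems in \<open>auto intro!: mult_left_mono powr_mono2\<close>)
      ultimately have "w k * nsum d ws (k - d) \<le> 2 / real (Suc k) * (C * real (Suc k) powr (e / 2))"
        using wk C(1) by (meson mult_left_mono mult_right_mono order.trans mult_nonneg_nonneg powr_ge_zero)
      \<comment> \<open>Half of the exponent \<open>e\<close> is spent on making the remaining sum over \<open>k\<close> converge.\<close>
      also have "\<dots> = 2 * C * (real (Suc k) powr e * real (Suc k) powr (- 1 - e / 2))"
      proof -
        have "real (Suc k) powr e * real (Suc k) powr (- 1 - e / 2) = real (Suc k) powr (e / 2 - 1)"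
          by (simp flip: powr_add)
        then show ?thesis by (simp add: powr_diff)
      qed
      also have "\<dots> \<le> 2 * C * (real (Suc n) powr e * real (Suc k) powr (- 1 - e / 2))"
        using k C Cons.prems by (intro mult_left_mono mult_right_mono powr_mono2) auto
      finally show ?thesis by (simp add: mult_ac)
    qed
    then have "nsum d (w # ws) n
        \<le> (\<Sum>k=1..n. 2 * C * real (Suc n) powr e * real (Suc k) powr (- 1 - e / 2))"
      unfolding nsum.simps by (rule sum_mono)
    also have "\<dots> \<le> 2 * C * real (Suc n) powr e * Z"
      unfolding sum_distrib_left[symmetric] Z_def using C Cons.prems
      by (intro mult_left_mono sum_Suc_powr_le) auto
    finally show ?thesis by (simp add: mult_ac)
  qed
  then show ?case using C \<open>Z \<ge> 0\<close> by (intro exI[of _ "2 * C * Z"]) auto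
qed

text \<open>A leading weight of order k^(-2) beats the growth of the tail: with exponent 1/2 for the
  tail, the terms are O(k^(-3/2)).\<close>

lemma nsum_bounded:
  assumes ws: "\<And>v k. v \<in> set ws \<Longrightarrow> k \<ge> 1 \<Longrightarrow> 0 \<le> v k \<and> v k \<le> 1 / real k"
    and w: "\<And>k. k \<ge> 1 \<Longrightarrow> 0 \<le> w k \<and> w k \<le> 1 / real k ^ 2"
  shows "\<exists>M. \<forall>n. nsum d (w # ws) n \<le> M"
proof -
  obtain C where C: "C \<ge> 0" "\<And>n. nsum d ws n \<le> C * real (Suc n) powr (1 / 2)"
    using nsum_powr_bound[of ws "1 / 2" d] ws by auto
  have "nsum d (w # ws) n \<le> 4 * C * (\<Sum>k. real k powr (- 3 / 2))" for n
  proof -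
    have "w k * nsum d ws (k - d) \<le> 4 * C * real (Suc k) powr (- 3 / 2)" if k: "k \<in> {1..n}" for k
    proof -
      have wk: "0 \<le> w k" "w k \<le> 1 / real k ^ 2" using w[of k] k by auto
      have "real (Suc k) ^ 2 \<le> (2 * real k) ^ 2" using k by (intro power_mono) auto
      then have "1 / real k ^ 2 \<le> 4 / real (Suc k) ^ 2"
        using k by (simp add: field_simps power_mult_distrib del: of_nat_Suc)
      then have "w k \<le> 4 / real (Suc k) ^ 2" using wk by linarith
      moreover have "nsum d ws (k - d) \<le> C * real (Suc k) powr (1 / 2)"
        by (rule order.trans[OF C(2)]) (use C in \<open>auto intro!: mult_left_mono powr_mono2\<close>)
      ultimately have "w k * nsum d ws (k - d) \<le> 4 / real (Suc k) ^ 2 * (C * real (Suc k) powr (1 / 2))"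
        using wk C(1) by (meson mult_left_mono mult_right_mono order.trans mult_nonneg_nonneg powr_ge_zero)
      also have "\<dots> = 4 * C * (real (Suc k) powr (1 / 2) / real (Suc k) powr 2)"
        by (simp add: powr_numeral del: of_nat_Suc)
      also have "real (Suc k) powr (1 / 2) / real (Suc k) powr 2 = real (Suc k) powr (- 3 / 2)"
        by (subst powr_diff[symmetric]) simp
      finally show ?thesis .
    qed
    then have "nsum d (w # ws) n \<le> (\<Sum>k=1..n. 4 * C * real (Suc k) powr (- 3 / 2))"
      unfolding nsum.simps by (rule sum_mono)
    also have "\<dots> \<le> 4 * C * (\<Sum>k. real k powr (- 3 / 2))"
      unfolding sum_distrib_left[symmetric] using C
      by (intro mult_left_mono sum_Suc_powr_le) auto
    finally show ?thesis .
  qed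
  then show ?thesis by blast
qed

subsection \<open>The kernel\<close>

text \<open>For 1 <= k <= n this is the binomial coefficient (2n-1 choose n-k) times a factor
  depending on \<open>n\<close> only. The value 0 for \<open>k > n\<close> lets sums over
  \<open>k\<close> be extended past \<open>n\<close>.\<close>

definition kern :: "nat \<Rightarrow> nat \<Rightarrow> real" where
  "kern n k = (if k \<le> n then pochhammer (1 / 2) n ^ 2 / (fact (n - k) * fact (n + k - 1)) else 0)"

lemma kern_nonneg: "0 \<le> kern n k"
  by (simp add: kern_def)

text \<open>For k <= n the ratio of \<open>kern n k\<close> to \<open>kern (Suc n) k\<close> is
  4(n+1-k)(n+k) / (2n+1)^2, and 4(n+1-k)(n+k) = (2n+1)^2 - (2k-1)^2.\<close>

lemma kern_Suc_left:
  assumes "k \<ge> 1"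
  shows "kern (Suc n) k - kern n k = (2 * real k - 1)\<^sup>2 / (2 * real (Suc n) - 1)\<^sup>2 * kern (Suc n) k"
proof (cases "k \<le> n")
  case True
  define m where "m = n - k"
  have n: "n = m + k" and "Suc n - k = Suc m" using True by (auto simp: m_def)
  obtain j where j: "k = Suc j" using assms by (cases k) auto
  define F :: real where "F = fact m"
  define G :: real where "G = fact (n + j)"
  define P :: real where "P = pochhammer (1 / 2) n"
  have pos: "F \<noteq> 0" "G \<noteq> 0" by (auto simp: F_def G_def)
  have 1: "kern n k = P\<^sup>2 / (F * G)"
    using True by (simp add: kern_def P_def F_def G_def m_def j)
  have "kern (Suc n) k = (P * (1 / 2 + real n))\<^sup>2 / ((real m + 1) * F * ((real n + real k) * G))"
    using True \<open>Suc n - k = Suc m\<close>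
    by (simp add: kern_def P_def F_def G_def pochhammer_Suc j algebra_simps)
  then have "kern (Suc n) k * (4 * (real m + 1) * (real n + real k)) = (2 * real n + 1)\<^sup>2 * kern n k"
  proof -
    define x y z where "x = real m + 1" and "y = real n + real k" and "z = 2 * real n + 1"
    have "1 / 2 + real n = z / 2" "x \<noteq> 0" "y \<noteq> 0" by (auto simp: x_def y_def z_def j)
    then have "(P * (1 / 2 + real n))\<^sup>2 / (x * F * (y * G)) * (4 * x * y) = z\<^sup>2 * (P\<^sup>2 / (F * G))"
      using pos by (simp only: power2_eq_square) (simp add: field_simps)
    then show ?thesis
      unfolding 1 \<open>kern (Suc n) k = _\<close> by (simp only: x_def y_def z_def)
  qed
  moreover have "4 * (real m + 1) * (real n + real k) = (2 * real n + 1)\<^sup>2 - (2 * real k - 1)\<^sup>2"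
    by (simp add: n power2_eq_square algebra_simps)
  ultimately have "kern (Suc n) k * ((2 * real n + 1)\<^sup>2 - (2 * real k - 1)\<^sup>2) = (2 * real n + 1)\<^sup>2 * kern n k"
    by simp
  moreover have "(2 * real n + 1)\<^sup>2 \<noteq> 0" by (simp add: add_nonneg_eq_0_iff)
  ultimately show ?thesis
    by (simp add: field_simps)
next
  case False
  \<comment> \<open>At k = n+1 the smaller kernel vanishes and the quotient of squares is 1; beyond
    that both kernels vanish.\<close>
  then have "k = Suc n \<or> k > Suc n" by auto
  then show ?thesis by (auto simp: kern_def field_simps)
qed

text \<open>In this form, without division, the recurrence also covers \<open>k >= n\<close>, where
  both sides vanish.\<close>

lemma kern_Suc_right:
  "kern n (Suc k) * (real n + real k) = kern n k * (real n - real k)"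
proof (cases "k < n")
  case True
  define m where "m = n - Suc k"
  have n: "n - k = Suc m" "n = m + Suc k" using True by (auto simp: m_def)
  have "fact (n + k) = (real n + real k) * fact (n + k - 1)"
    using True by (cases "n + k") (auto simp del: of_nat_add simp flip: of_nat_add)
  moreover have "real n + real k > 0" using True by simp
  ultimately have "kern n (Suc k) * (real n + real k) = pochhammer (1 / 2) n ^ 2 / (fact m * fact (n + k - 1))"
    using True by (simp add: kern_def m_def)
  also have "\<dots> = kern n k * (real n - real k)"
    using True n(1) by (simp add: kern_def of_nat_diff[symmetric] n(1) del: of_nat_Suc)
  finally show ?thesis .
next
  case False
  then show ?thesis by (cases "k = n") (auto simp: kern_def)
qed

section \<open>Limit of the kernel\<close>

lemma kern_tendsto_Suc: "(\<lambda>n. kern n (Suc k)) \<longlonglongrightarrow> 1 / pi"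
proof (induction k)
  case 0
  \<comment> \<open>\<open>W n\<close> is the partial Wallis product, tending to pi/2. Clearing
    factorials gives \<open>kern n 1\<close> = n / ((2n+1) W(n)), with limit (1/2)(2/pi).\<close>
  define W where "W n = (\<Prod>k=1..n. (4 * real k ^ 2) / (4 * real k ^ 2 - 1))" for n
  have W: "W n * pochhammer (1 / 2) n ^ 2 * (2 * real n + 1) = fact n ^ 2" for n
  proof (induction n)
    case (Suc n)
    have "4 * real (Suc n) ^ 2 - 1 = (2 * real n + 1) * (2 * real n + 3)"
      by (simp add: power2_eq_square algebra_simps)
    then have W_Suc: "W (Suc n) = W n * (4 * real (Suc n) ^ 2 / ((2 * real n + 1) * (2 * real n + 3)))"
      by (simp add: W_def)
    have "W (Suc n) * pochhammer (1 / 2) (Suc n) ^ 2 * (2 * real (Suc n) + 1) =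
        (W n * pochhammer (1 / 2) n ^ 2 * (2 * real n + 1)) * real (Suc n) ^ 2"
    proof -
      define p where "p = pochhammer (1 / 2 :: real) n"
      define y z where "y = 2 * real n + 3" and "z = 2 * real n + 1"
      have *: "2 * real (Suc n) + 1 = y" "pochhammer (1 / 2) (Suc n) = p * (z / 2)"
        and "y \<noteq> 0" "z \<noteq> 0"
        by (auto simp: y_def z_def p_def pochhammer_Suc)
      then show ?thesis
        unfolding * W_Suc p_def[symmetric] y_def[symmetric] z_def[symmetric]
        by (simp add: power2_eq_square del: of_nat_Suc)
    qed
    then show ?case by (simp only: Suc.IH) (simp add: power_mult_distrib mult.commute)
  qed (simp add: W_def)
  have eq: "kern n 1 = real n / (2 * real n + 1) * inverse (W n)" for n
  proof (cases n)
    case (Suc m)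
    have "W n \<noteq> 0" "pochhammer (1 / 2 :: real) n ^ 2 \<noteq> 0" using W[of n] by auto
    moreover have "kern n 1 * fact n ^ 2 = real n * pochhammer (1 / 2) n ^ 2"
      by (simp add: Suc kern_def power2_eq_square)
    then have "kern n 1 = real n * pochhammer (1 / 2) n ^ 2 / fact n ^ 2"
      by (simp add: field_simps)
    moreover define z where "z = 2 * real n + 1"
    then have "z \<noteq> 0" by simp
    ultimately show ?thesis
      unfolding W[symmetric] z_def[symmetric] by (simp add: divide_simps mult_ac)
  qed (simp add: kern_def)
  have "(\<lambda>n. real n / (2 * real n + 1)) \<longlonglongrightarrow> 1 / 2" by real_asymp
  moreover have "W \<longlonglongrightarrow> pi / 2" using wallis by (simp add: W_def[abs_def])
  ultimately have "(\<lambda>n. real n / (2 * real n + 1) * inverse (W n)) \<longlonglongrightarrow> 1 / 2 * inverse (pi / 2)"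
    by (intro tendsto_mult tendsto_inverse) auto
  moreover have "1 / 2 * inverse (pi / 2) = 1 / pi" by simp
  ultimately show ?case unfolding eq[symmetric] by simp
next
  case (Suc k)
  \<comment> \<open>By \<open>kern_Suc_right\<close> neighbouring kernels differ by a factor tending
    to 1, so the limit is the same for every \<open>k\<close>.\<close>
  have "(\<lambda>n. kern n (Suc k) * ((real n - real (Suc k)) / (real n + real (Suc k)))) \<longlonglongrightarrow> 1 / pi * 1"
    by (intro tendsto_mult Suc.IH) real_asymp
  moreover have "kern n (Suc k) * ((real n - real (Suc k)) / (real n + real (Suc k))) = kern n (Suc (Suc k))" for n
  proof -
    have "real n + real (Suc k) \<noteq> 0" by linarith
    then show ?thesis using kern_Suc_right[of n "Suc k"] by (simp add: field_simps)
  qed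
  ultimately show ?case by simp
qed

text \<open>Increments in \<open>n\<close> are nonnegative by \<open>kern_Suc_left\<close>, so the
  limit is an upper bound. It is uniform in \<open>k\<close> and supplies the dominating series for
  Tannery's theorem.\<close>

lemma kern_le: "kern n (Suc k) \<le> 1 / pi"
proof -
  have "incseq (\<lambda>n. kern n (Suc k))"
  proof (rule incseq_SucI)
    fix n
    have "0 \<le> kern (Suc n) (Suc k) - kern n (Suc k)"
      by (subst kern_Suc_left) (auto simp: kern_nonneg)
    then show "kern n (Suc k) \<le> kern (Suc n) (Suc k)" by simp
  qed
  then show ?thesis using kern_tendsto_Suc by (rule incseq_le)
qed

lemma kern_sum_tendsto:
  assumes "summable (\<lambda>k. \<bar>x (Suc k)\<bar>)" and "(\<lambda>n. \<Sum>k=1..n. x k) \<longlonglongrightarrow> L"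
  shows "(\<lambda>n. \<Sum>k=1..n. kern n k * x k) \<longlonglongrightarrow> L / pi"
proof -
  have shift: "(\<Sum>k=1..n. y k) = (\<Sum>k<n. y (Suc k))" for n and y :: "nat \<Rightarrow> real"
    by (rule sum.reindex_bij_witness[where i = Suc and j = "\<lambda>k. k - 1"]) auto
  have "(\<lambda>n. \<Sum>k. kern n (Suc k) * x (Suc k)) \<longlonglongrightarrow> (\<Sum>k. 1 / pi * x (Suc k))"
  proof (rule tannerys_theorem[THEN conjunct2, THEN conjunct2])
    show "\<forall>\<^sub>F (k, n) in sequentially \<times>\<^sub>F sequentially. norm (kern n (Suc k) * x (Suc k)) \<le> 1 / pi * \<bar>x (Suc k)\<bar>"
      by (intro always_eventually) (use mult_right_mono[OF kern_le] in \<open>auto simp: abs_mult kern_nonneg\<close>)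
    show "summable (\<lambda>k. 1 / pi * \<bar>x (Suc k)\<bar>)" using assms(1) by (rule summable_mult)
    show "(\<lambda>n. kern n (Suc k) * x (Suc k)) \<longlonglongrightarrow> 1 / pi * x (Suc k)" for k
      by (intro tendsto_mult tendsto_const kern_tendsto_Suc)
  qed simp
  moreover have "(\<Sum>k. kern n (Suc k) * x (Suc k)) = (\<Sum>k=1..n. kern n k * x k)" for n
    unfolding shift by (intro suminf_finite) (auto simp: kern_def)
  moreover have "(\<lambda>k. x (Suc k)) sums L"
    unfolding sums_def using assms(2) unfolding shift .
  then have "(\<Sum>k. 1 / pi * x (Suc k)) = L / pi"
    using sums_mult[of _ L "1 / pi"] by (simp add: sums_iff)
  ultimately show ?thesis by simp
qed

text \<open>Put D(k) = \<open>kern n k * (real n - real k)\<close>, which equals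
  \<open>kern n (Suc k) * (real n + real k)\<close>. Since 2k+1 and 2n-1 are the difference and the
  sum of n+k and n-k-1, the two products are the difference and the sum of D(k) and D(k+1). Moreover
  D(n) = 0.\<close>

lemma telescope_kern:
  "kern n (Suc k) * (2 * real (Suc k) - 1) = kern n k * (real n - real k) - kern n (Suc k) * (real n - real (Suc k))"
  "kern n (Suc k) * (2 * real n - 1) = kern n k * (real n - real k) + kern n (Suc k) * (real n - real (Suc k))"
  using kern_Suc_right[of n k] by (auto simp: algebra_simps)

subsection \<open>Truncated t-values\<close>

definition odd_pow :: "bool \<Rightarrow> nat \<Rightarrow> nat \<Rightarrow> real" where
  "odd_pow b s k = (if b then (- 1) ^ k else 1) / (2 * real k - 1) ^ s"

lemma odd_nonzero: "2 * real k - 1 \<noteq> 0"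
proof
  assume "2 * real k - 1 = 0"
  then have "real (2 * k) = real 1" by simp
  then have "2 * k = 1" by (simp only: of_nat_eq_iff)
  then show False by presburger
qed

text \<open>Two signs (-1)^k cancel, so bars combine by exclusive or.\<close>

lemma odd_pow_mult: "odd_pow b s k * odd_pow b' s' k = odd_pow (b \<noteq> b') (s + s') k"
  by (auto simp: odd_pow_def power_add simp flip: power_mult_distrib)

lemma abs_odd_pow: "k \<ge> 1 \<Longrightarrow> \<bar>odd_pow b s k\<bar> = 1 / (2 * real k - 1) ^ s"
  by (auto simp: odd_pow_def power_abs abs_divide)

lemma abs_odd_pow_le:
  assumes "k \<ge> 1" "r \<le> s"
  shows "\<bar>odd_pow b s k\<bar> \<le> 1 / real k ^ r"
proof -
  have "real k ^ r \<le> (2 * real k - 1) ^ r" using assms by (intro power_mono) auto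
  also have "\<dots> \<le> (2 * real k - 1) ^ s" using assms by (intro power_increasing) auto
  finally show ?thesis
    using assms by (simp add: abs_odd_pow frac_le)
qed

lemma nsum_odd_pow_bounded:
  assumes "s \<ge> 2" and "\<forall>p\<in>set ss. fst p \<ge> 1"
  shows "\<exists>M. \<forall>n. nsum d (map (\<lambda>w k. \<bar>w k\<bar>) (map (\<lambda>(r, b). odd_pow b r) ((s, b) # ss))) n \<le> M"
proof -
  have "\<exists>M. \<forall>n. nsum d ((\<lambda>k. \<bar>odd_pow b s k\<bar>) # map (\<lambda>(r, b) k. \<bar>odd_pow b r k\<bar>) ss) n \<le> M"
  proof (rule nsum_bounded)
    fix v :: "nat \<Rightarrow> real" and k :: nat
    assume "v \<in> set (map (\<lambda>(r, b) k. \<bar>odd_pow b r k\<bar>) ss)" and "k \<ge> 1"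
    then show "0 \<le> v k \<and> v k \<le> 1 / real k"
      using assms(2) abs_odd_pow_le[of k 1] by fastforce
  qed (use assms(1) in \<open>auto intro: abs_odd_pow_le\<close>)
  then show ?thesis by (simp add: comp_def case_prod_unfold)
qed

lemma UN_gap_lists: "(\<Union>n. gap_lists d r n) =
    {ks. length ks = r \<and> sorted_wrt (\<lambda>x y. y + d \<le> x) ks \<and> (\<forall>k\<in>set ks. 1 \<le> k)}"
proof (intro equalityI subsetI)
  fix ks assume "ks \<in> {ks. length ks = r \<and> sorted_wrt (\<lambda>x y. y + d \<le> x) ks \<and> (\<forall>k\<in>set ks. 1 \<le> k)}"
  \<comment> \<open>For the empty list \<open>Max\<close> is unspecified, which is harmless as there
    is no entry to bound.\<close>
  then have "ks \<in> gap_lists d r (Max (set ks))" by (auto simp: gap_lists_def)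
  then show "ks \<in> (\<Union>n. gap_lists d r n)" by blast
qed (fastforce simp: gap_lists_def)

lemma tval_tendsto:
  assumes "s \<ge> 2" and "\<forall>p\<in>set ss. fst p \<ge> 1"
  shows "nsum 1 (map (\<lambda>(r, b). odd_pow b r) ((s, b) # ss)) \<longlonglongrightarrow> tval ((s, b) # ss)"
proof -
  let ?ws = "map (\<lambda>(r, b). odd_pow b r) ((s, b) # ss)"
  obtain M where "\<And>n. nsum 1 (map (\<lambda>w k. \<bar>w k\<bar>) ?ws) n \<le> M"
    using nsum_odd_pow_bounded[OF assms, where d = 1 and b = b] by blast
  from nsum_tendsto_infsum[OF this]
  have "nsum 1 ?ws \<longlonglongrightarrow> infsum (\<lambda>ks. \<Prod>j<length ?ws. (?ws ! j) (ks ! j)) (\<Union>n. gap_lists 1 (length ?ws) n)" .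
  moreover have "(\<lambda>x y. y + 1 \<le> x) = ((>) :: nat \<Rightarrow> _)" by (auto simp: fun_eq_iff)
  moreover have "(\<Prod>j<length ?ws. (?ws ! j) (ks ! j)) = (\<Prod>j<length ((s, b) # ss).
        (if snd (((s, b) # ss) ! j) then (-1) ^ (ks ! j) else 1) / (2 * real (ks ! j) - 1) ^ fst (((s, b) # ss) ! j))" for ks
    by (intro prod.cong) (auto simp: odd_pow_def case_prod_unfold simp del: list.map)
  ultimately show ?thesis
    unfolding tval_def UN_gap_lists by (simp del: list.map)
qed

lemma tstar_tendsto:
  assumes "ss \<noteq> []" and "hd ss \<ge> 2" and "\<forall>r\<in>set ss. r \<ge> 1"
  shows "nsum 0 (map (odd_pow False) ss) \<longlonglongrightarrow> tstar ss"
proof -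
  let ?ws = "map (odd_pow False) ss"
  have "\<exists>M. \<forall>n. nsum 0 (map (\<lambda>w k. \<bar>w k\<bar>) ?ws) n \<le> M"
    using nsum_odd_pow_bounded[of "hd ss" "map (\<lambda>r. (r, False)) (tl ss)" 0 False] assms
    by (cases ss) (auto simp: comp_def)
  then obtain M where "\<And>n. nsum 0 (map (\<lambda>w k. \<bar>w k\<bar>) ?ws) n \<le> M" by blast
  from nsum_tendsto_infsum[OF this]
  have "nsum 0 ?ws \<longlonglongrightarrow> infsum (\<lambda>ks. \<Prod>j<length ?ws. (?ws ! j) (ks ! j)) (\<Union>n. gap_lists 0 (length ?ws) n)" .
  moreover have "(\<Prod>j<length ?ws. (?ws ! j) (ks ! j)) =
      (\<Prod>j<length ss. 1 / (2 * real (ks ! j) - 1) ^ (ss ! j))" for ks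
    by (intro prod.cong) (auto simp: odd_pow_def simp del: list.map)
  ultimately show ?thesis
    unfolding tstar_def UN_gap_lists by (simp del: list.map)
qed

text \<open>The kernel weights only the outermost index \<open>k\<close>; the inner sum depends on
  \<open>k\<close> but not on \<open>n\<close>. Absolute convergence of the t-value therefore makes
  \<open>kern_sum_tendsto\<close> applicable.\<close>

lemma kern_sum_tendsto_tval:
  assumes "s \<ge> 2" and "\<forall>p\<in>set ss. fst p \<ge> 1"
  shows "(\<lambda>n. \<Sum>k=1..n. kern n k * (odd_pow b s k * nsum 1 (map (\<lambda>(r, b). odd_pow b r) ss) (k - 1)))
    \<longlonglongrightarrow> tval ((s, b) # ss) / pi"
proof (rule kern_sum_tendsto)
  let ?ws = "map (\<lambda>(r, b). odd_pow b r) ss"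
  obtain M where M: "\<And>n. nsum 1 (map (\<lambda>w k. \<bar>w k\<bar>) (odd_pow b s # ?ws)) n \<le> M"
    using nsum_odd_pow_bounded[OF assms, where d = 1 and b = b] by auto
  show "summable (\<lambda>k. \<bar>odd_pow b s (Suc k) * nsum 1 ?ws (Suc k - 1)\<bar>)"
  proof (rule summableI_nonneg_bounded)
    fix n
    have "(\<Sum>k<n. \<bar>odd_pow b s (Suc k) * nsum 1 ?ws (Suc k - 1)\<bar>)
        = (\<Sum>k=1..n. \<bar>odd_pow b s k\<bar> * \<bar>nsum 1 ?ws (k - 1)\<bar>)"
      by (rule sum.reindex_bij_witness[where j = Suc and i = "\<lambda>k. k - 1"]) (auto simp: abs_mult)
    also have "\<dots> \<le> nsum 1 (map (\<lambda>w k. \<bar>w k\<bar>) (odd_pow b s # ?ws)) n"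
      unfolding list.map nsum.simps by (intro sum_mono mult_left_mono abs_nsum_le) auto
    also have "\<dots> \<le> M" by (rule M)
    finally show "(\<Sum>k<n. \<bar>odd_pow b s (Suc k) * nsum 1 ?ws (Suc k - 1)\<bar>) \<le> M" .
  qed simp
  show "(\<lambda>n. \<Sum>k=1..n. odd_pow b s k * nsum 1 ?ws (k - 1)) \<longlonglongrightarrow> tval ((s, b) # ss)"
  proof -
    have "(\<lambda>n. \<Sum>k=1..n. odd_pow b s k * nsum 1 ?ws (k - 1)) =
        nsum 1 (map (\<lambda>(r, b). odd_pow b r) ((s, b) # ss))"
      by (rule ext) simp
    then show ?thesis using tval_tendsto[OF assms, where b = b] by simp
  qed
qed

subsection \<open>Kernel representations of truncated star sums\<close>

text \<open>With S the partial sums of \<open>y\<close>, this is S(k) + S(k-1) for k >= 1, the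
  combination that Abel summation against the kernel produces.\<close>

definition hsum :: "(nat \<Rightarrow> real) \<Rightarrow> nat \<Rightarrow> real" where
  "hsum y k = y k + 2 * (\<Sum>l=1..k - 1. y l)"

lemma hsum_Suc: "hsum y (Suc k) = (\<Sum>l=1..Suc k. y l) + (\<Sum>l=1..k. y l)"
  by (simp add: hsum_def)

lemma hsum_add: "hsum (\<lambda>l. y l + z l) k = hsum y k + hsum z k"
  by (simp add: hsum_def sum.distrib algebra_simps)

lemma hsum_cmult: "hsum (\<lambda>l. c * y l) k = c * hsum y k"
  by (simp add: hsum_def sum_distrib_left[symmetric] algebra_simps)

text \<open>The diagonal term l = k stays in the outer entry; the terms l < k open a new strictly
  smaller index with a factor 2. This doubling leads from the coefficient -4 to -8 and -16.\<close>

lemma hsum_nsum: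
  "hsum (\<lambda>l. w l * nsum 1 ws (l - 1)) k = w k * nsum 1 ws (k - 1) + 2 * nsum 1 (w # ws) (k - 1)"
  by (simp add: hsum_def)

lemma sum_kern_hsum:
  "(\<Sum>k=1..n. kern n k * (2 * real k - 1) * hsum y k) = (2 * real n - 1) * (\<Sum>k=1..n. kern n k * y k)"
proof -
  \<comment> \<open>The row \<open>n\<close> is fixed while the upper limit \<open>N\<close> varies;
    the boundary term contains n - N and drops out at N = n.\<close>
  have "(\<Sum>k=1..N. kern n k * (2 * real k - 1) * hsum y k) =
      (\<Sum>k=1..N. kern n k * (2 * real n - 1) * y k) - 2 * (kern n N * (real n - real N)) * (\<Sum>l=1..N. y l)" for N
  proof (induction N)
    case (Suc N)
    show ?case
      by (simp only: sum.cl_ivl_Suc Suc.IH hsum_Suc telescope_kern) (simp add: algebra_simps)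
  qed simp
  from this[of n] show ?thesis by (simp add: sum_distrib_left mult_ac)
qed

text \<open>With alternating signs it is sums of consecutive boundary terms that telescope, not
  differences, so 2n-1 and 2k-1 exchange roles compared with \<open>sum_kern_hsum\<close>.\<close>

lemma sum_kern_alternating_hsum:
  "(2 * real n - 1) * (\<Sum>k=1..n. kern n k * ((- 1) ^ k * hsum y k)) =
    (\<Sum>k=1..n. kern n k * ((2 * real k - 1) * ((- 1) ^ k * y k)))"
proof -
  have "(\<Sum>k=1..N. (- 1) ^ k * (kern n k * (2 * real n - 1)) * hsum y k) =
      (\<Sum>k=1..N. (- 1) ^ k * (kern n k * (2 * real k - 1)) * y k)
      + 2 * ((- 1) ^ N * (kern n N * (real n - real N))) * (\<Sum>l=1..N. y l)" for N
  proof (induction N)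
    case (Suc N)
    show ?case
      by (simp only: sum.cl_ivl_Suc Suc.IH hsum_Suc telescope_kern) (simp add: algebra_simps)
  qed simp
  from this[of n] show ?thesis by (simp add: sum_distrib_left mult_ac)
qed

lemma sum_kern_alternating_eq_0:
  assumes "n \<ge> 2"
  shows "(\<Sum>k=1..n. kern n k * ((- 1) ^ k * (2 * real k - 1))) = 0"
proof -
  have "(\<Sum>k=1..N. (- 1) ^ k * (2 * real k - 1) * (real n - 1) * kern n k) =
      (- 1) ^ N * real N * (kern n N * (real n - real N))" for N
  proof (induction N)
    case (Suc N)
    show ?case
      by (simp only: sum.cl_ivl_Suc Suc.IH kern_Suc_right[of n N, symmetric]) (simp add: algebra_simps)
  qed simp
  \<comment> \<open>The boundary term vanishes at N = n. Cancelling n-1 needs n >= 2; for n = 1 the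
    sum is -1/4.\<close>
  from this[of n] have "(real n - 1) * (\<Sum>k=1..n. kern n k * ((- 1) ^ k * (2 * real k - 1))) = 0"
    by (simp add: sum_distrib_left mult_ac)
  then show ?thesis using assms by simp
qed

text \<open>The range starts at n = 1 because at n = 0 the kernel sum is empty, whereas the
  truncated sum of the empty index is 1.\<close>

definition kern_rep :: "(nat \<Rightarrow> real) \<Rightarrow> (nat \<Rightarrow> real) \<Rightarrow> bool" where
  "kern_rep f u \<longleftrightarrow> (\<forall>n\<ge>1. u n = (\<Sum>k=1..n. kern n k * f k))"

lemma kern_rep_cong: "kern_rep f u \<Longrightarrow> (\<And>k. k \<ge> 1 \<Longrightarrow> f k = g k) \<Longrightarrow> kern_rep g u"
  by (simp add: kern_rep_def)

lemma kern_Suc_sum: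
  "(\<Sum>k=1..Suc n. kern (Suc n) k * f k) = (\<Sum>k=1..n. kern n k * f k) +
    (\<Sum>k=1..Suc n. kern (Suc n) k * ((2 * real k - 1)\<^sup>2 * f k)) / (2 * real (Suc n) - 1)\<^sup>2"
proof -
  have "(\<Sum>k=1..n. kern n k * f k) = (\<Sum>k=1..Suc n. kern n k * f k)" by (simp add: kern_def)
  moreover have "(\<Sum>k=1..Suc n. kern (Suc n) k * f k) - (\<Sum>k=1..Suc n. kern n k * f k) =
      (\<Sum>k=1..Suc n. (kern (Suc n) k - kern n k) * f k)"
    by (simp only: sum_subtractf left_diff_distrib)
  moreover have "\<dots> = (\<Sum>k=1..Suc n. kern (Suc n) k * ((2 * real k - 1)\<^sup>2 * f k)) / (2 * real (Suc n) - 1)\<^sup>2"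
    unfolding sum_divide_distrib by (intro sum.cong refl) (simp add: kern_Suc_left)
  ultimately show ?thesis by linarith
qed

text \<open>Passing from \<open>n\<close> to \<open>n + 1\<close> changes the sum by a multiple of
  the one in \<open>sum_kern_alternating_eq_0\<close>, which is 0. So it keeps its value -1/4 from n
  = 1, which dictates the factor -4.\<close>

lemma kern_rep_one: "kern_rep (\<lambda>k. - 4 * odd_pow True 1 k) (nsum 0 [])"
proof -
  have "(\<Sum>k=1..Suc n. kern (Suc n) k * ((- 1) ^ k / (2 * real k - 1))) = - 1 / 4" for n
  proof (induction n)
    case 0
    show ?case by (simp add: kern_def power2_eq_square)
  next
    case (Suc n)
    have *: "(2 * real k - 1)\<^sup>2 * ((- 1) ^ k / (2 * real k - 1)) = (- 1) ^ k * (2 * real k - 1)" for k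
      using odd_nonzero[of k] by (simp add: power2_eq_square)
    have zero: "(\<Sum>k=1..Suc (Suc n). kern (Suc (Suc n)) k * ((- 1) ^ k * (2 * real k - 1))) = 0"
      by (rule sum_kern_alternating_eq_0) simp
    show ?case
      by (subst kern_Suc_sum) (simp only: Suc.IH * zero div_0 add_0_right)
  qed
  then have "(\<Sum>k=1..n. kern n k * ((- 1) ^ k / (2 * real k - 1))) = - 1 / 4" if "n \<ge> 1" for n
    using that by (cases n) auto
  moreover have "(\<Sum>k=1..n. kern n k * (- 4 * odd_pow True 1 k)) =
      - 4 * (\<Sum>k=1..n. kern n k * ((- 1) ^ k / (2 * real k - 1)))" for n
    unfolding sum_distrib_left by (intro sum.cong) (auto simp: odd_pow_def)
  ultimately show ?thesis by (simp add: kern_rep_def)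
qed

text \<open>Both sides are 0 at n = 0, so it suffices to compare increments: by
  \<open>kern_Suc_sum\<close> the second assumption, divided by (2n-1)^2, equates them.\<close>

lemma kern_rep_Cons:
  assumes "kern_rep g (nsum 0 ws)"
    and "\<And>n. n \<ge> 1 \<Longrightarrow> (\<Sum>k=1..n. kern n k * ((2 * real k - 1)\<^sup>2 * f k)) =
      (2 * real n - 1)\<^sup>2 * w n * (\<Sum>k=1..n. kern n k * g k)"
  shows "kern_rep f (nsum 0 (w # ws))"
proof -
  have "nsum 0 (w # ws) n = (\<Sum>k=1..n. kern n k * f k)" for n
  proof (induction n)
    case (Suc n)
    have "nsum 0 (w # ws) (Suc n) = nsum 0 (w # ws) n + w (Suc n) * nsum 0 ws (Suc n)" by simp
    also have "\<dots> = (\<Sum>k=1..Suc n. kern (Suc n) k * f k)"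
      unfolding Suc.IH kern_Suc_sum[where f = f] using assms(1) odd_nonzero[of "Suc n"]
      by (subst assms(2)) (auto simp: kern_rep_def)
    finally show ?case .
  qed simp
  then show ?thesis by (simp add: kern_rep_def)
qed

lemma kern_rep_Cons_2:
  assumes "kern_rep g (nsum 0 ws)"
  shows "kern_rep (\<lambda>k. odd_pow False 2 k * g k) (nsum 0 (odd_pow False 2 # ws))"
  by (rule kern_rep_Cons[OF assms]) (simp add: odd_pow_def odd_nonzero)

lemma kern_rep_replicate_2:
  assumes "kern_rep g (nsum 0 ws)"
  shows "kern_rep (\<lambda>k. odd_pow False (2 * a) k * g k) (nsum 0 (replicate a (odd_pow False 2) @ ws))"
proof (induction a)
  case 0
  show ?case using assms by (simp add: odd_pow_def)
next
  case (Suc a)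
  have "kern_rep (\<lambda>k. odd_pow False (2 * Suc a) k * g k)
      (nsum 0 (odd_pow False 2 # replicate a (odd_pow False 2) @ ws))"
    by (rule kern_rep_cong[OF kern_rep_Cons_2[OF Suc.IH]]) (simp add: odd_pow_mult flip: mult.assoc)
  then show ?case by (simp only: replicate_Suc append_Cons)
qed

text \<open>For the weight 1/(2n-1) the increment condition is \<open>sum_kern_hsum\<close>.\<close>

lemma kern_rep_Cons_1:
  assumes "kern_rep g (nsum 0 ws)"
  shows "kern_rep (\<lambda>k. odd_pow False 1 k * hsum g k) (nsum 0 (odd_pow False 1 # ws))"
proof (rule kern_rep_Cons[OF assms])
  fix n
  have 1: "(2 * real k - 1)\<^sup>2 * (odd_pow False 1 k * hsum g k) = (2 * real k - 1) * hsum g k" for k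
    using odd_nonzero[of k] by (simp add: odd_pow_def power2_eq_square)
  have 2: "(2 * real n - 1)\<^sup>2 * odd_pow False 1 n = 2 * real n - 1"
    using odd_nonzero[of n] by (simp add: odd_pow_def power2_eq_square)
  show "(\<Sum>k=1..n. kern n k * ((2 * real k - 1)\<^sup>2 * (odd_pow False 1 k * hsum g k))) =
      (2 * real n - 1)\<^sup>2 * odd_pow False 1 n * (\<Sum>k=1..n. kern n k * g k)"
    unfolding 1 2 sum_kern_hsum[symmetric] by (simp only: mult.assoc)
qed

text \<open>For the weight 1/(2n-1)^3 the increment condition comes from
  \<open>sum_kern_alternating_hsum\<close>; the inner twist by \<open>odd_pow True 1\<close> turns
  its right side into the kernel sum of \<open>g\<close>.\<close>

lemma kern_rep_Cons_3:
  assumes "kern_rep g (nsum 0 ws)"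
  shows "kern_rep (\<lambda>k. odd_pow True 2 k * hsum (\<lambda>l. odd_pow True 1 l * g l) k) (nsum 0 (odd_pow False 3 # ws))"
proof (rule kern_rep_Cons[OF assms])
  fix n
  let ?y = "\<lambda>l. odd_pow True 1 l * g l"
  have 1: "(2 * real k - 1)\<^sup>2 * (odd_pow True 2 k * hsum ?y k) = (- 1) ^ k * hsum ?y k" for k
    using odd_nonzero[of k] by (simp add: odd_pow_def)
  have 2: "(2 * real k - 1) * ((- 1) ^ k * ?y k) = g k" for k
    using odd_nonzero[of k] by (simp add: odd_pow_def flip: power_mult_distrib)
  have 3: "(2 * real n - 1)\<^sup>2 * odd_pow False 3 n = 1 / (2 * real n - 1)"
    using odd_nonzero[of n] by (simp add: odd_pow_def power2_eq_square power3_eq_cube)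
  show "(\<Sum>k=1..n. kern n k * ((2 * real k - 1)\<^sup>2 * (odd_pow True 2 k * hsum ?y k))) =
      (2 * real n - 1)\<^sup>2 * odd_pow False 3 n * (\<Sum>k=1..n. kern n k * g k)"
    unfolding 1 3 sum_kern_alternating_hsum[of n ?y, unfolded 2, symmetric]
    using odd_nonzero[of n] by simp
qed


section \<open>Bookkeeping of coefficients and passage to the limit\<close>

lemma kern_rep_tendsto_unique:
  assumes "kern_rep f u" and "u \<longlonglongrightarrow> L" and "(\<lambda>n. \<Sum>k=1..n. kern n k * f k) \<longlonglongrightarrow> L'"
  shows "L = L'"
proof (rule LIMSEQ_unique[OF assms(2)])
  show "u \<longlonglongrightarrow> L'"
    using assms(3) by (rule Lim_transform_eventually)
      (use assms(1) in \<open>auto simp: kern_rep_def intro!: eventually_sequentiallyI[of 1]\<close>)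
qed

lemma odd_pow_mult_term:
  "odd_pow b s k * (c * (odd_pow b' s' k * x)) = c * (odd_pow (b \<noteq> b') (s + s') k * x)"
  unfolding odd_pow_mult[symmetric] by simp

lemma hsum_term:
  "hsum (\<lambda>l. c * (w l * nsum 1 ws (l - 1))) k = c * (w k * nsum 1 ws (k - 1)) + 2 * c * nsum 1 (w # ws) (k - 1)"
  unfolding hsum_cmult hsum_nsum by (simp add: algebra_simps)

lemma mult_nsum_term: "odd_pow b s k * (c * nsum d ws j) = c * (odd_pow b s k * nsum d ws j)"
  by simp

text \<open>These rules keep a coefficient function a sum of terms
  \<open>c * (odd_pow b s k * nsum 1 ws (k - 1))\<close>, the shape whose kernel sums tend to
  multiples of t-values.\<close>

lemmas term_simps = distrib_left hsum_add hsum_term odd_pow_mult_term mult_nsum_term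

text \<open>The factor \<open>nsum 1 [] (k - 1)\<close>, equal to 1, brings the single term into the
  shape that \<open>hsum_term\<close> expects.\<close>

lemma kern_rep_twos:
  "kern_rep (\<lambda>k. - 4 * (odd_pow True (2 * c + 1) k * nsum 1 [] (k - 1))) (nsum 0 (replicate c (odd_pow False 2)))"
proof -
  have "kern_rep (\<lambda>k. odd_pow False (2 * c) k * (- 4 * odd_pow True 1 k)) (nsum 0 (replicate c (odd_pow False 2)))"
    using kern_rep_replicate_2[OF kern_rep_one, of c] by (simp only: append_Nil2)
  then show ?thesis
  proof (rule kern_rep_cong)
    show "odd_pow False (2 * c) k * (- 4 * odd_pow True 1 k) = - 4 * (odd_pow True (2 * c + 1) k * nsum 1 [] (k - 1))" for k
      using odd_pow_mult_term[of False "2 * c" k "- 4" True 1 1] by simp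
  qed
qed

text \<open>The index is built from the right. The entries 1 and 3 each split every term in two
  through \<open>hsum\<close>, giving four; bars come from the base term and from the twists at
  3.\<close>

lemma kern_rep_twos_3_twos_1_twos:
  "kern_rep (\<lambda>k. - 4 * (odd_pow True (2*a+2*b+2*c+5) k * nsum 1 [] (k - 1))
      + - 8 * (odd_pow True (2*a+2) k * nsum 1 [odd_pow False (2*b+2*c+3)] (k - 1))
      + - 8 * (odd_pow False (2*a+2*b+4) k * nsum 1 [odd_pow True (2*c+1)] (k - 1))
      + - 16 * (odd_pow True (2*a+2) k * nsum 1 [odd_pow True (2*b+2), odd_pow True (2*c+1)] (k - 1)))
    (nsum 0 (map (odd_pow False) (replicate a 2 @ [3] @ replicate b 2 @ [1] @ replicate c 2)))"
  unfolding map_append map_replicate list.map append.simps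
  by (rule kern_rep_cong[OF kern_rep_replicate_2[OF kern_rep_Cons_3[OF
          kern_rep_replicate_2[OF kern_rep_Cons_1[OF kern_rep_twos]]]]],
      simp only: term_simps, simp add: numeral_eq_Suc add_ac del: nsum.simps)

text \<open>Here the inner twist of the right-hand 3 cancels the bar of the base term, so the
  innermost entry becomes 2c+2 without a bar.\<close>

lemma kern_rep_twos_3_twos_3_twos:
  "kern_rep (\<lambda>k. - 4 * (odd_pow True (2*a+2*b+2*c+7) k * nsum 1 [] (k - 1))
      + - 8 * (odd_pow True (2*a+2) k * nsum 1 [odd_pow False (2*b+2*c+5)] (k - 1))
      + - 8 * (odd_pow True (2*a+2*b+5) k * nsum 1 [odd_pow False (2*c+2)] (k - 1))
      + - 16 * (odd_pow True (2*a+2) k * nsum 1 [odd_pow False (2*b+3), odd_pow False (2*c+2)] (k - 1)))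
    (nsum 0 (map (odd_pow False) (replicate a 2 @ [3] @ replicate b 2 @ [3] @ replicate c 2)))"
  unfolding map_append map_replicate list.map append.simps
  by (rule kern_rep_cong[OF kern_rep_replicate_2[OF kern_rep_Cons_3[OF
          kern_rep_replicate_2[OF kern_rep_Cons_3[OF kern_rep_twos]]]]],
      simp only: term_simps, simp add: numeral_eq_Suc add_ac del: nsum.simps)

text \<open>Both identities have the same four-term shape, so the limit is taken once with exponents
  and bars as parameters.\<close>

lemma tstar_eq_of_kern_rep:
  assumes ss: "ss \<noteq> []" "hd ss \<ge> 2" "\<forall>r\<in>set ss. r \<ge> 1"
    and rep: "kern_rep (\<lambda>k. - 4 * (odd_pow p1 s1 k * nsum 1 [] (k - 1))
      + - 8 * (odd_pow p2 s2 k * nsum 1 [odd_pow q2 r2] (k - 1))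
      + - 8 * (odd_pow p3 s3 k * nsum 1 [odd_pow q3 r3] (k - 1))
      + - 16 * (odd_pow p4 s4 k * nsum 1 [odd_pow q4 r4, odd_pow q5 r5] (k - 1)))
      (nsum 0 (map (odd_pow False) ss))"
    and ge: "s1 \<ge> 2" "s2 \<ge> 2" "s3 \<ge> 2" "s4 \<ge> 2" "r2 \<ge> 1" "r3 \<ge> 1" "r4 \<ge> 1" "r5 \<ge> 1"
  shows "tstar ss = - 4 / pi * tval [(s1, p1)] - 8 / pi * tval [(s2, p2), (r2, q2)]
    - 8 / pi * tval [(s3, p3), (r3, q3)] - 16 / pi * tval [(s4, p4), (r4, q4), (r5, q5)]"
proof -
  define K where "K b s ws n = (\<Sum>k=1..n. kern n k * (odd_pow b s k * nsum 1 ws (k - 1)))" for b s ws n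
  have K: "K b s (map (\<lambda>(r, b). odd_pow b r) idx) \<longlonglongrightarrow> tval ((s, b) # idx) / pi"
    if "s \<ge> 2" "\<forall>p\<in>set idx. fst p \<ge> 1" for b s idx
    unfolding K_def using kern_sum_tendsto_tval[OF that] .
  have "(\<lambda>n. - 4 * K p1 s1 [] n + - 8 * K p2 s2 [odd_pow q2 r2] n
        + - 8 * K p3 s3 [odd_pow q3 r3] n + - 16 * K p4 s4 [odd_pow q4 r4, odd_pow q5 r5] n)
      \<longlonglongrightarrow> - 4 * (tval [(s1, p1)] / pi) + - 8 * (tval [(s2, p2), (r2, q2)] / pi)
        + - 8 * (tval [(s3, p3), (r3, q3)] / pi) + - 16 * (tval [(s4, p4), (r4, q4), (r5, q5)] / pi)"
    using K[of s1 "[]" p1] K[of s2 "[(r2, q2)]" p2] K[of s3 "[(r3, q3)]" p3]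
      K[of s4 "[(r4, q4), (r5, q5)]" p4] ge
    by (intro tendsto_add tendsto_mult_left) auto
  also have "(\<lambda>n. - 4 * K p1 s1 [] n + - 8 * K p2 s2 [odd_pow q2 r2] n
        + - 8 * K p3 s3 [odd_pow q3 r3] n + - 16 * K p4 s4 [odd_pow q4 r4, odd_pow q5 r5] n) =
      (\<lambda>n. \<Sum>k=1..n. kern n k * (- 4 * (odd_pow p1 s1 k * nsum 1 [] (k - 1))
      + - 8 * (odd_pow p2 s2 k * nsum 1 [odd_pow q2 r2] (k - 1))
      + - 8 * (odd_pow p3 s3 k * nsum 1 [odd_pow q3 r3] (k - 1))
      + - 16 * (odd_pow p4 s4 k * nsum 1 [odd_pow q4 r4, odd_pow q5 r5] (k - 1))))"
    by (simp only: K_def distrib_left sum.distrib sum_distrib_left mult.left_commute)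
  finally show ?thesis
    using kern_rep_tendsto_unique[OF rep tstar_tendsto[OF ss]] by simp
qed

theorem theorem4p5:
  fixes a b c :: nat
  shows "(tstar (replicate a 2 @ [3] @ replicate b 2 @ [1] @ replicate c 2) =
           - 4 / pi * tval [(2*a+2*b+2*c+5, True)]
           - 8 / pi * tval [(2*a+2, True), (2*b+2*c+3, False)]
           - 8 / pi * tval [(2*a+2*b+4, False), (2*c+1, True)]
           - 16 / pi * tval [(2*a+2, True), (2*b+2, True), (2*c+1, True)]) \<and>
         (tstar (replicate a 2 @ [3] @ replicate b 2 @ [3] @ replicate c 2) =
           - 4 / pi * tval [(2*a+2*b+2*c+7, True)]
           - 8 / pi * tval [(2*a+2, True), (2*b+2*c+5, False)]
           - 8 / pi * tval [(2*a+2*b+5, True), (2*c+2, False)]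
           - 16 / pi * tval [(2*a+2, True), (2*b+3, False), (2*c+2, False)])"
proof
  show "tstar (replicate a 2 @ [3] @ replicate b 2 @ [1] @ replicate c 2) =
           - 4 / pi * tval [(2*a+2*b+2*c+5, True)]
           - 8 / pi * tval [(2*a+2, True), (2*b+2*c+3, False)]
           - 8 / pi * tval [(2*a+2*b+4, False), (2*c+1, True)]
           - 16 / pi * tval [(2*a+2, True), (2*b+2, True), (2*c+1, True)]"
    \<comment> \<open>The leading entry is 3 if a = 0 and 2 otherwise, so the convergence condition
      holds either way.\<close>
    by (rule tstar_eq_of_kern_rep[OF _ _ _ kern_rep_twos_3_twos_1_twos]) (auto simp: hd_append)
  show "tstar (replicate a 2 @ [3] @ replicate b 2 @ [3] @ replicate c 2) =
           - 4 / pi * tval [(2*a+2*b+2*c+7, True)]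
           - 8 / pi * tval [(2*a+2, True), (2*b+2*c+5, False)]
           - 8 / pi * tval [(2*a+2*b+5, True), (2*c+2, False)]
           - 16 / pi * tval [(2*a+2, True), (2*b+3, False), (2*c+2, False)]"
    by (rule tstar_eq_of_kern_rep[OF _ _ _ kern_rep_twos_3_twos_3_twos]) (auto simp: hd_append)
qed

end
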